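(* Let $\Pi=\{0=x_0<x_1<\cdots<x_{N_c}=1\}$ be a partition of $[0,1]$ with cells $I_j:=(x_{j-1},x_j)$. Let $\mathcal F=\mathcal F(x,z,p,q)$ be a smooth real-valued function and let $$F(x;u)=\mathcal F(x,u,u_x,u_{xx})-g(x),\qquad J(u)=\frac12\int_0^1F(x;u)^2\,dx,$$ where $u\in C^1([0,1])\cap C^4_\Pi$ and $g\in C^2_\Pi$. Set $r:=F(\cdot;u)$. Let $\mathcal V_\Pi$ be the space of all $v\in C^1([0,1])\cap C^2_\Pi$ satisfying the prescribed homogeneous endpoint conditions. Then, for every $v\in\mathcal V_\Pi$, $$DJ(u)[v]=\sum_{j=1}^{N_c}\int_{I_j}(DF(u)^*r)\,v\,dx+\mathcal S_u(r,v).$$ Moreover, $u$ is a critical point of $J$ with respect to $\mathcal V_\Pi$ (that is, $DJ(u)[v]=0$ for every $v\in\mathcal V_\Pi$) if and only if both the cellwise adjoint equations $$DF(u)^*r=0\qquad\text{on each }I_j$$ and the boundary and interface condition $$\mathcal S_u(r,v)=0\qquad\text{for every }v\in\mathcal V_\Pi$$ hold.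
   Context: $C^m_\Pi$ denotes the functions whose restriction to each cell $I_j$ extends to a $C^m$ function on $[x_{j-1},x_j]$, with no matching at the interior points of $\Pi$ required. $DJ(u)[v]:=\frac{d}{dt}J(u+tv)\big|_{t=0}$. With $a:=\mathcal F_q$, $b:=\mathcal F_p$, $c:=\mathcal F_z$ evaluated at $(x,u(x),u_x(x),u_{xx}(x))$, the linearization and its formal adjoint are defined on each cell by $$DF(u)[v]=a v_{xx}+b v_x+c v,\qquad DF(u)^*r=(ar)_{xx}-(br)_x+cr.$$ The boundary and interface functional is $$\mathcal S_u(r,v):=\sum_{j=1}^{N_c}\Bigl[\int_{I_j}r\,DF(u)[v]\,dx-\int_{I_j}(DF(u)^*r)\,v\,dx\Bigr],$$ equivalently $$\mathcal S_u(r,v)=\sum_{j=1}^{N_c}\Bigl[ar\,v_x+\bigl(br-(ar)_x\bigr)v\Bigr]_{x_{j-1}^+}^{x_j^-}.$$ The "prescribed homogeneous endpoint conditions" are any fixed set of homogeneous linear conditions on the values of $v$ and $v_x$ at the endpoints $0$ and $1$ (for example the Dirichlet conditions $v(0)=v(1)=0$). *)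

theory Defs
  imports "HOL-Analysis.Analysis"
begin

(* Continuous differentiability on a set S that need not be open. The derivative within S is
   only unique on suitable S; here S is {a..b} or {0..1} \<times> UNIV, which are convex with nonempty
   interior, so at boundary points this means one-sided derivatives. *)
primrec Ck_on :: "nat \<Rightarrow> 'a::euclidean_space set \<Rightarrow> ('a \<Rightarrow> real) \<Rightarrow> bool" where
  "Ck_on 0 S f \<longleftrightarrow> continuous_on S f"
| "Ck_on (Suc k) S f \<longleftrightarrow>
     (\<exists>f'. (\<forall>p\<in>S. (f has_derivative f' p) (at p within S)) \<and> (\<forall>h. Ck_on k S (\<lambda>p. f' p h)))"

definition smooth_on :: "'a::euclidean_space set \<Rightarrow> ('a \<Rightarrow> real) \<Rightarrow> bool" where
  "smooth_on S f \<longleftrightarrow> (\<forall>k. Ck_on k S f)"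

definition is_partition :: "nat \<Rightarrow> (nat \<Rightarrow> real) \<Rightarrow> bool" where
  "is_partition N xs \<longleftrightarrow> xs 0 = 0 \<and> xs N = 1 \<and> (\<forall>j<N. xs j < xs (Suc j))"

(* Cells are indexed by j = 1, ..., N. *)
definition cell :: "(nat \<Rightarrow> real) \<Rightarrow> nat \<Rightarrow> real set" where
  "cell xs j = {xs (j - 1)<..<xs j}"

definition Ck_cells :: "nat \<Rightarrow> nat \<Rightarrow> (nat \<Rightarrow> real) \<Rightarrow> (real \<Rightarrow> real) \<Rightarrow> bool" where
  "Ck_cells m N xs f \<longleftrightarrow>
     (\<forall>j\<in>{1..N}. \<exists>h. Ck_on m {xs (j - 1)..xs j} h \<and> (\<forall>t\<in>cell xs j. f t = h t))"

(* The x-derivative on [0,1], one-sided at 0 and 1. On the open cells it is the ordinary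
   derivative. Where f is not differentiable (possible for u_x at the interior nodes) the value
   is unspecified; this affects none of the integrals below. *)
definition ddx :: "(real \<Rightarrow> real) \<Rightarrow> real \<Rightarrow> real" where
  "ddx f x = vector_derivative f (at x within {0..1})"

type_synonym integrand = "real \<Rightarrow> real \<Rightarrow> real \<Rightarrow> real \<Rightarrow> real"

definition residual :: "integrand \<Rightarrow> (real \<Rightarrow> real) \<Rightarrow> (real \<Rightarrow> real) \<Rightarrow> real \<Rightarrow> real" where
  "residual F g u x = F x (u x) (ddx u x) (ddx (ddx u) x) - g x"

definition J :: "integrand \<Rightarrow> (real \<Rightarrow> real) \<Rightarrow> (real \<Rightarrow> real) \<Rightarrow> real" where
  "J F g u = 1 / 2 * integral {0..1} (\<lambda>x. (residual F g u x)\<^sup>2)"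

definition DJ :: "integrand \<Rightarrow> (real \<Rightarrow> real) \<Rightarrow> (real \<Rightarrow> real) \<Rightarrow> (real \<Rightarrow> real) \<Rightarrow> real" where
  "DJ F g u v = deriv (\<lambda>t. J F g (\<lambda>x. u x + t * v x)) 0"

definition coeff_a :: "integrand \<Rightarrow> (real \<Rightarrow> real) \<Rightarrow> real \<Rightarrow> real" where
  "coeff_a F u x = deriv (\<lambda>q. F x (u x) (ddx u x) q) (ddx (ddx u) x)"

definition coeff_b :: "integrand \<Rightarrow> (real \<Rightarrow> real) \<Rightarrow> real \<Rightarrow> real" where
  "coeff_b F u x = deriv (\<lambda>p. F x (u x) p (ddx (ddx u) x)) (ddx u x)"

definition coeff_c :: "integrand \<Rightarrow> (real \<Rightarrow> real) \<Rightarrow> real \<Rightarrow> real" where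
  "coeff_c F u x = deriv (\<lambda>z. F x z (ddx u x) (ddx (ddx u) x)) (u x)"

definition DF :: "integrand \<Rightarrow> (real \<Rightarrow> real) \<Rightarrow> (real \<Rightarrow> real) \<Rightarrow> real \<Rightarrow> real" where
  "DF F u v x = coeff_a F u x * ddx (ddx v) x + coeff_b F u x * ddx v x + coeff_c F u x * v x"

definition DF_adjoint :: "integrand \<Rightarrow> (real \<Rightarrow> real) \<Rightarrow> (real \<Rightarrow> real) \<Rightarrow> real \<Rightarrow> real" where
  "DF_adjoint F u r x =
     ddx (ddx (\<lambda>s. coeff_a F u s * r s)) x - ddx (\<lambda>s. coeff_b F u s * r s) x + coeff_c F u x * r x"

definition interface_functional ::
  "integrand \<Rightarrow> nat \<Rightarrow> (nat \<Rightarrow> real) \<Rightarrow> (real \<Rightarrow> real) \<Rightarrow> (real \<Rightarrow> real) \<Rightarrow> (real \<Rightarrow> real) \<Rightarrow> real" where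
  "interface_functional F N xs u r v =
     (\<Sum>j = 1..N. integral (cell xs j) (\<lambda>x. r x * DF F u v x)
                - integral (cell xs j) (\<lambda>x. DF_adjoint F u r x * v x))"

(* A tuple (\<alpha>, \<beta>, \<gamma>, \<delta>) \<in> B encodes the condition
   \<alpha> v(0) + \<beta> v_x(0) + \<gamma> v(1) + \<delta> v_x(1) = 0. *)
definition endpoint_conditions :: "(real \<times> real \<times> real \<times> real) set \<Rightarrow> (real \<Rightarrow> real) \<Rightarrow> bool" where
  "endpoint_conditions B v \<longleftrightarrow>
     (\<forall>(\<alpha>, \<beta>, \<gamma>, \<delta>)\<in>B. \<alpha> * v 0 + \<beta> * ddx v 0 + \<gamma> * v 1 + \<delta> * ddx v 1 = 0)"

definition variations ::
  "nat \<Rightarrow> (nat \<Rightarrow> real) \<Rightarrow> (real \<times> real \<times> real \<times> real) set \<Rightarrow> (real \<Rightarrow> real) set" where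
  "variations N xs B = {v. Ck_on 1 {0..1} v \<and> Ck_cells 2 N xs v \<and> endpoint_conditions B v}"

definition critical_point ::
  "integrand \<Rightarrow> (real \<Rightarrow> real) \<Rightarrow> (real \<Rightarrow> real) set \<Rightarrow> (real \<Rightarrow> real) \<Rightarrow> bool" where
  "critical_point F g V u \<longleftrightarrow> (\<forall>v\<in>V. DJ F g u v = 0)"

end

theory Submission
  imports Defs
begin

text \<open>
  Differentiating \<^term>\<open>J F g\<close> under the integral sign on each cell, where the integrand extends
  continuously to the closed cell, gives \<open>DJ(u)[v] = \<Sum>\<^sub>j \<integral> r DF(u)[v]\<close>, and the first formula is then the
  definition of the interface functional. For a bump function \<open>v\<close> supported inside one cell, the
  boundary terms of the Lagrange identity
  \<open>r DF(u)[v] - (DF(u)\<^sup>* r) v = (a r v\<^sub>x + (b r - (a r)\<^sub>x) v)\<^sub>x\<close> vanish and every endpoint condition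
  holds, so at a critical point the fundamental lemma of the calculus of variations yields the
  adjoint equation on that cell; what is left of the first formula is the interface condition.
\<close>

section \<open>Functions of class $C^k$\<close>

lemma Ck_on_subset: "Ck_on k S f \<Longrightarrow> T \<subseteq> S \<Longrightarrow> Ck_on k T f"
proof (induction k arbitrary: f)
  case 0
  then show ?case by (auto intro: continuous_on_subset)
next
  case (Suc k)
  then show ?case by simp (meson has_derivative_subset subset_iff)
qed

text \<open>Continuity is demanded only at the bottom level of the recursion; differentiability
  supplies it one level up, and the induction then passes to the derivative components.\<close>

lemma Ck_on_Suc_imp: "Ck_on (Suc k) S f \<Longrightarrow> Ck_on k S f"
proof (induction k arbitrary: f)
  case 0
  then show ?case
    by (auto intro!: continuous_at_imp_continuous_on simp: continuous_on_eq_continuous_within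
        dest!: bspec has_derivative_continuous)
next
  case (Suc k)
  from Suc.prems obtain f' where "\<forall>p\<in>S. (f has_derivative f' p) (at p within S)"
    "\<forall>h. Ck_on (Suc k) S (\<lambda>p. f' p h)" unfolding Ck_on.simps(2)[of "Suc k"] by blast
  with Suc.IH show ?case unfolding Ck_on.simps(2)[of k] by blast
qed

lemma Ck_on_mono: "Ck_on k S f \<Longrightarrow> m \<le> k \<Longrightarrow> Ck_on m S f"
proof (induction k)
  case (Suc k)
  then show ?case using Ck_on_Suc_imp le_Suc_eq by blast
qed simp

lemma Ck_on_imp_continuous_on: "Ck_on k S f \<Longrightarrow> continuous_on S f"
  using Ck_on_mono[of k S f 0] by simp

lemma Ck_on_const [simp]: "Ck_on k S (\<lambda>x. c)"
proof (induction k arbitrary: c)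
  case (Suc k)
  have "\<forall>p\<in>S. ((\<lambda>x. c) has_derivative (\<lambda>_. 0)) (at p within S)" by simp
  then show ?case using Suc[of 0] unfolding Ck_on.simps by (intro exI[of _ "\<lambda>_ _. 0"]) auto
qed simp

lemma Ck_on_linear: "bounded_linear f \<Longrightarrow> Ck_on k S f"
proof (induction k)
  case (Suc k)
  then show ?case unfolding Ck_on.simps
    by (intro exI[of _ "\<lambda>_. f"]) (auto intro: bounded_linear_imp_has_derivative)
qed (auto intro: linear_continuous_on)

lemma Ck_on_add: "Ck_on k S f \<Longrightarrow> Ck_on k S g \<Longrightarrow> Ck_on k S (\<lambda>x. f x + g x)"
proof (induction k arbitrary: f g)
  case 0
  then show ?case by (auto intro: continuous_intros)
next
  case (Suc k)
  then obtain f' g' where "\<forall>p\<in>S. (f has_derivative f' p) (at p within S)"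
    "\<forall>h. Ck_on k S (\<lambda>p. f' p h)" "\<forall>p\<in>S. (g has_derivative g' p) (at p within S)"
    "\<forall>h. Ck_on k S (\<lambda>p. g' p h)" by (auto simp: Ck_on.simps)
  then show ?case unfolding Ck_on.simps
    by (intro exI[of _ "\<lambda>p h. f' p h + g' p h"]) (auto intro: has_derivative_add Suc.IH)
qed

lemma Ck_on_mult: "Ck_on k S f \<Longrightarrow> Ck_on k S g \<Longrightarrow> Ck_on k S (\<lambda>x. f x * g x)"
proof (induction k arbitrary: f g)
  case 0
  then show ?case by (auto intro: continuous_intros)
next
  case (Suc k)
  then obtain f' g' where *: "\<forall>p\<in>S. (f has_derivative f' p) (at p within S)"
    "\<forall>h. Ck_on k S (\<lambda>p. f' p h)" "\<forall>p\<in>S. (g has_derivative g' p) (at p within S)"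
    "\<forall>h. Ck_on k S (\<lambda>p. g' p h)" by (auto simp: Ck_on.simps)
  \<comment> \<open>The product rule leaves one factor undifferentiated in each term, so the factors
    themselves are needed at level \<open>k\<close> too.\<close>
  have "Ck_on k S f" "Ck_on k S g" using Suc.prems by (blast intro: Ck_on_Suc_imp)+
  with * show ?case unfolding Ck_on.simps
    by (intro exI[of _ "\<lambda>p h. f p * g' p h + f' p h * g p"])
      (auto intro!: has_derivative_mult Ck_on_add Suc.IH)
qed

lemma Ck_on_sum:
  "finite A \<Longrightarrow> (\<And>i. i \<in> A \<Longrightarrow> Ck_on k S (f i)) \<Longrightarrow> Ck_on k S (\<lambda>x. \<Sum>i\<in>A. f i x)"
  by (induction rule: finite_induct) (auto intro: Ck_on_add)

text \<open>Chain rule by induction on \<open>k\<close>. Since \<open>Ck_on\<close> concerns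
  real-valued functions, the inner map is controlled through its coordinates. \<open>G\<close> stays
  arbitrary because the induction hypothesis is applied to the directional derivatives of
  \<open>G\<close>.\<close>

lemma Ck_on_compose:
  fixes G :: "'b::euclidean_space \<Rightarrow> real" and \<gamma> :: "'a::euclidean_space \<Rightarrow> 'b"
  assumes "Ck_on k T G" "\<And>b. b \<in> Basis \<Longrightarrow> Ck_on k S (\<lambda>x. \<gamma> x \<bullet> b)" "\<gamma> ` S \<subseteq> T"
  shows "Ck_on k S (\<lambda>x. G (\<gamma> x))"
  using assms
proof (induction k arbitrary: G)
  case 0
  have "continuous_on S \<gamma>"
    using 0 by (intro continuous_on_componentwise[THEN iffD2]) auto
  then show ?case using 0 by (auto intro: continuous_on_compose2)
next
  case (Suc k)
  obtain G' where G': "\<And>p. p \<in> T \<Longrightarrow> (G has_derivative G' p) (at p within T)"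
    and G'k: "\<And>h. Ck_on k T (\<lambda>p. G' p h)" using Suc.prems(1) by auto
  have "\<forall>b\<in>Basis. \<exists>f'. (\<forall>p\<in>S. ((\<lambda>x. \<gamma> x \<bullet> b) has_derivative f' p) (at p within S)) \<and>
      (\<forall>h. Ck_on k S (\<lambda>p. f' p h))"
    using Suc.prems(2) by simp
  then obtain D where D: "\<And>b p. b \<in> Basis \<Longrightarrow> p \<in> S \<Longrightarrow>
        ((\<lambda>x. \<gamma> x \<bullet> b) has_derivative D b p) (at p within S)"
    and Dk: "\<And>b h. b \<in> Basis \<Longrightarrow> Ck_on k S (\<lambda>p. D b p h)" by metis
  define L where "L p h = (\<Sum>b\<in>Basis. D b p h *\<^sub>R b)" for p h
  have "(\<gamma> has_derivative L p) (at p within S)" if "p \<in> S" for p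
    unfolding has_derivative_componentwise_within[of \<gamma>] L_def
    using D that by (simp add: inner_sum_left_Basis)
  then have "((\<lambda>x. G (\<gamma> x)) has_derivative (\<lambda>h. G' (\<gamma> p) (L p h))) (at p within S)" if "p \<in> S" for p
    using has_derivative_in_compose2[OF G' Suc.prems(3) that] that by blast
  \<comment> \<open>The direction \<open>L p h\<close> moves with \<open>p\<close>, whereas the
    class of \<open>G'\<close> is known only for fixed directions. Expanding in the basis leaves
    sums of products of functions of class \<open>k\<close>.\<close>
  moreover have "G' (\<gamma> p) (L p h) = (\<Sum>b\<in>Basis. D b p h * G' (\<gamma> p) b)" if "p \<in> S" for p h
  proof -
    have "linear (G' (\<gamma> p))"
      using G'[of "\<gamma> p"] that Suc.prems(3) by (auto intro: has_derivative_linear)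
    then show ?thesis by (simp add: L_def linear_sum linear_scale)
  qed
  ultimately have "((\<lambda>x. G (\<gamma> x)) has_derivative (\<lambda>h. \<Sum>b\<in>Basis. D b p h * G' (\<gamma> p) b)) (at p within S)"
    if "p \<in> S" for p using that by simp
  moreover have "Ck_on k S (\<lambda>x. G' (\<gamma> x) b)" for b
    using Suc.prems G'k by (intro Suc.IH[of "\<lambda>p. G' p b"]) (auto intro: Ck_on_Suc_imp simp del: Ck_on.simps)
  ultimately show ?case unfolding Ck_on.simps
    by (intro exI[of _ "\<lambda>p h. \<Sum>b\<in>Basis. D b p h * G' (\<gamma> p) b"])
      (auto intro!: Ck_on_sum Ck_on_mult Dk)
qed

section \<open>Piecewise $C^k$ functions\<close>

lemma partition_bounds:
  assumes "is_partition N xs" "j \<in> {1..N}"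
  shows "0 \<le> xs (j - 1)" "xs (j - 1) < xs j" "xs j \<le> 1"
proof -
  have step: "xs i < xs (Suc i)" if "i < N" for i using assms that by (simp add: is_partition_def)
  have mono: "xs i \<le> xs k" if "i \<le> k" "k \<le> N" for i k
    using that
  proof (induction rule: dec_induct)
    case (step n)
    then show ?case using assms(1) unfolding is_partition_def by (smt (verit) Suc_le_lessD less_imp_le_nat)
  qed simp
  have ends: "xs 0 = 0" "xs N = 1" using assms by (auto simp: is_partition_def)
  show "0 \<le> xs (j - 1)" using mono[of 0 "j - 1"] assms ends by auto
  show "xs j \<le> 1" using mono[of j N] assms ends by auto
  show "xs (j - 1) < xs j" using step[of "j - 1"] assms by auto
qed

lemma has_integral_partition:
  fixes f :: "real \<Rightarrow> real"
  assumes "is_partition N xs"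
    and "\<And>j. j \<in> {1..N} \<Longrightarrow> (f has_integral I j) {xs (j - 1)..xs j}"
  shows "(f has_integral (\<Sum>j = 1..N. I j)) {0..1}"
proof -
  have step: "xs i < xs (Suc i)" if "i < N" for i using assms that by (simp add: is_partition_def)
  have "xs 0 \<le> xs n \<and> (f has_integral (\<Sum>j = 1..n. I j)) {xs 0..xs n}" if "n \<le> N" for n
    using that
  proof (induction n)
    case 0
    then show ?case by (simp add: has_integral_refl)
  next
    case (Suc n)
    then have "(f has_integral (\<Sum>j = 1..n. I j) + I (Suc n)) {xs 0..xs (Suc n)}"
      using assms(2)[of "Suc n"] step[of n] by (intro has_integral_combine[of _ "xs n"]) auto
    then show ?case using Suc step[of n] by auto
  qed
  from this[of N] show ?thesis using assms by (simp add: is_partition_def)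
qed

text \<open>Data such as the second derivative are controlled only on the open cell; the two nodes
  form a finite, hence negligible, set.\<close>

lemma has_integral_spike_cell:
  assumes "(f has_integral I) {xs (j - 1)..xs j}" "\<And>x. x \<in> cell xs j \<Longrightarrow> g x = f x"
  shows "(g has_integral I) {xs (j - 1)..xs j}"
  using assms
  by (intro has_integral_spike_finite[of "{xs (j - 1), xs j}" _ g f]) (auto simp: cell_def)

lemma integral_cell:
  fixes f :: "real \<Rightarrow> real"
  shows "integral (cell xs j) f = integral {xs (j - 1)..xs j} f"
  unfolding cell_def by (rule integral_open_interval_real[symmetric])

text \<open>Derivatives within the nondegenerate interval [0,1] are unique, at 0 and 1 as
  well.\<close>

lemma ddx_eqI:
  assumes "(f has_real_derivative D) (at x within {0..1})" "x \<in> {0..1}"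
  shows "ddx f x = D"
  unfolding ddx_def using assms
  by (intro vector_derivative_within_closed_interval)
    (auto simp: has_real_derivative_iff_has_vector_derivative)

section \<open>Algebra and differentiation of piecewise functions\<close>

lemma Ck_cells_cong:
  assumes "Ck_cells m N xs f" "\<And>j x. j \<in> {1..N} \<Longrightarrow> x \<in> cell xs j \<Longrightarrow> g x = f x"
  shows "Ck_cells m N xs g"
  using assms unfolding Ck_cells_def by fastforce

lemma Ck_cells_mono: "Ck_cells k N xs f \<Longrightarrow> m \<le> k \<Longrightarrow> Ck_cells m N xs f"
  unfolding Ck_cells_def using Ck_on_mono by blast

lemma Ck_cells_add:
  assumes "Ck_cells m N xs f" "Ck_cells m N xs g" shows "Ck_cells m N xs (\<lambda>x. f x + g x)"
  unfolding Ck_cells_def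
proof
  fix j assume j: "j \<in> {1..N}"
  obtain h k where "Ck_on m {xs (j - 1)..xs j} h" "\<forall>t\<in>cell xs j. f t = h t"
    "Ck_on m {xs (j - 1)..xs j} k" "\<forall>t\<in>cell xs j. g t = k t"
    using assms j unfolding Ck_cells_def by meson
  then show "\<exists>h. Ck_on m {xs (j - 1)..xs j} h \<and> (\<forall>t\<in>cell xs j. f t + g t = h t)"
    by (intro exI[of _ "\<lambda>x. h x + k x"]) (auto intro: Ck_on_add)
qed

lemma Ck_cells_mult:
  assumes "Ck_cells m N xs f" "Ck_cells m N xs g" shows "Ck_cells m N xs (\<lambda>x. f x * g x)"
  unfolding Ck_cells_def
proof
  fix j assume j: "j \<in> {1..N}"
  obtain h k where "Ck_on m {xs (j - 1)..xs j} h" "\<forall>t\<in>cell xs j. f t = h t"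
    "Ck_on m {xs (j - 1)..xs j} k" "\<forall>t\<in>cell xs j. g t = k t"
    using assms j unfolding Ck_cells_def by meson
  then show "\<exists>h. Ck_on m {xs (j - 1)..xs j} h \<and> (\<forall>t\<in>cell xs j. f t * g t = h t)"
    by (intro exI[of _ "\<lambda>x. h x * k x"]) (auto intro: Ck_on_mult)
qed

lemma Ck_cells_const: "Ck_cells m N xs (\<lambda>x. c)"
  unfolding Ck_cells_def by (auto intro: exI[of _ "\<lambda>x. c"])

lemma Ck_cells_diff:
  assumes "Ck_cells m N xs f" "Ck_cells m N xs g" shows "Ck_cells m N xs (\<lambda>x. f x - g x)"
  using Ck_cells_add[OF assms(1) Ck_cells_mult[OF Ck_cells_const[of m N xs "-1"] assms(2)]] by simp

text \<open>Both claims come from one extension \<open>k\<close> to the closed cell: inside the cell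
  its one-sided derivative is an ordinary one and agrees with that of \<open>f\<close>, so
  \<open>k' t 1\<close> extends \<open>ddx f\<close>.\<close>

lemma Ck_cells_ddx_has_derivative:
  assumes "is_partition N xs" "Ck_cells (Suc m) N xs f"
  shows "Ck_cells m N xs (ddx f) \<and>
    (\<forall>j\<in>{1..N}. \<forall>x\<in>cell xs j. (f has_real_derivative ddx f x) (at x))"
proof -
  have "\<exists>h. Ck_on m {xs (j - 1)..xs j} h \<and>
      (\<forall>t\<in>cell xs j. ddx f t = h t \<and> (f has_real_derivative ddx f t) (at t))"
    if j: "j \<in> {1..N}" for j
  proof -
    obtain k where k: "Ck_on (Suc m) {xs (j - 1)..xs j} k" "\<And>t. t \<in> cell xs j \<Longrightarrow> f t = k t"
      using assms(2) j unfolding Ck_cells_def by blast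
    then obtain k' where k': "\<And>p. p \<in> {xs (j - 1)..xs j} \<Longrightarrow> (k has_derivative k' p) (at p within {xs (j - 1)..xs j})"
      "\<And>h. Ck_on m {xs (j - 1)..xs j} (\<lambda>p. k' p h)" unfolding Ck_on.simps by blast
    have "(f has_real_derivative k' t 1) (at t)" if t: "t \<in> cell xs j" for t
    proof -
      have t': "t \<in> interior {xs (j - 1)..xs j}" using t by (simp add: cell_def)
      then have "(k has_derivative k' t) (at t)"
        using k'(1)[of t] interior_subset by (metis at_within_interior subsetD)
      moreover from this have "k' t = (*) (k' t 1)"
        using has_derivative_linear[of k "k' t"] by (metis real_linearD mult.right_neutral)
      ultimately have "(k has_real_derivative k' t 1) (at t)"
        unfolding has_field_derivative_def by simp
      then show ?thesis
        using t k(2) by (subst DERIV_cong_ev[OF refl _ refl, of _ k])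
          (auto simp: eventually_nhds cell_def intro!: exI[of _ "cell xs j"])
    qed
    moreover have "ddx f t = k' t 1" if t: "t \<in> cell xs j" for t
      using calculation[OF t] t partition_bounds[OF assms(1) j]
      by (intro ddx_eqI) (auto simp: cell_def intro: has_field_derivative_at_within)
    ultimately show ?thesis by (intro exI[of _ "\<lambda>t. k' t 1"]) (auto simp del: One_nat_def intro: k')
  qed
  then show ?thesis unfolding Ck_cells_def by blast
qed

lemmas Ck_cells_ddx = Ck_cells_ddx_has_derivative[THEN conjunct1]
lemmas Ck_cells_has_derivative = Ck_cells_ddx_has_derivative[THEN conjunct2, rule_format]

lemma Ck_cells_imp_continuous_on:
  assumes "Ck_cells m N xs f" "j \<in> {1..N}" shows "continuous_on (cell xs j) f"
proof -
  obtain h where "Ck_on m {xs (j - 1)..xs j} h" "\<forall>t\<in>cell xs j. f t = h t"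
    using assms unfolding Ck_cells_def by blast
  moreover have "cell xs j \<subseteq> {xs (j - 1)..xs j}" by (auto simp: cell_def)
  ultimately show ?thesis
    by (metis Ck_on_imp_continuous_on continuous_on_subset continuous_on_cong)
qed

section \<open>Test functions supported in a cell\<close>

lemma Ck_on_SucI_real:
  assumes "\<And>x. x \<in> S \<Longrightarrow> (f has_real_derivative f' x) (at x within S)" "Ck_on k S f'"
  shows "Ck_on (Suc k) S f"
  unfolding Ck_on.simps using assms
  by (intro exI[of _ "\<lambda>x h. f' x * h"])
    (auto simp: has_field_derivative_def intro!: Ck_on_mult)

text \<open>An exponent of at least 2 flattens the kink of the positive part at 0; away from 0 the
  function is locally a power or zero.\<close>

lemma has_derivative_pos_part_power:
  "((\<lambda>s::real. max 0 s ^ Suc (Suc n)) has_real_derivative of_nat (Suc (Suc n)) * max 0 s ^ Suc n) (at s)"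
proof -
  consider "s > 0" | "s < 0" | "s = 0" by linarith
  then show ?thesis
  proof cases
    case 1
    have "((\<lambda>s. s ^ Suc (Suc n)) has_real_derivative of_nat (Suc (Suc n)) * s ^ Suc n) (at s)"
      using DERIV_pow[of "Suc (Suc n)" s] by simp
    then have "((\<lambda>s. max 0 s ^ Suc (Suc n)) has_real_derivative of_nat (Suc (Suc n)) * s ^ Suc n) (at s)"
      by (rule has_field_derivative_transform_within_open[of _ _ _ "{0<..}"]) (use 1 in auto)
    then show ?thesis using 1 by simp
  next
    case 2
    have "((\<lambda>s. max 0 s ^ Suc (Suc n)) has_real_derivative 0) (at s)"
      by (rule has_field_derivative_transform_within_open[of "\<lambda>_. 0" _ _ "{..<0}"]) (use 2 in auto)
    then show ?thesis using 2 by simp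
  next
    case 3
    have "((\<lambda>h::real. max 0 h ^ Suc n) \<longlongrightarrow> max 0 0 ^ Suc n) (at 0)"
      by (intro tendsto_intros)
    \<comment> \<open>Off zero, the difference quotient at 0 is the next lower power of the positive
      part, which tends to 0.\<close>
    moreover have "max 0 h ^ Suc n = (max 0 (0 + h) ^ Suc (Suc n) - max 0 0 ^ Suc (Suc n)) / h"
      if "h \<noteq> 0" for h :: real
      using that by (cases "h > 0") auto
    ultimately have "((\<lambda>h::real. (max 0 (0 + h) ^ Suc (Suc n) - max 0 0 ^ Suc (Suc n)) / h) \<longlongrightarrow> 0) (at 0)"
      using Lim_transform_eventually[of "\<lambda>h::real. max 0 h ^ Suc n" 0 "at 0"
          "\<lambda>h. (max 0 (0 + h) ^ Suc (Suc n) - max 0 0 ^ Suc (Suc n)) / h"]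
      by (simp add: eventually_at_filter)
    then show ?thesis using 3 unfolding DERIV_def by simp
  qed
qed

text \<open>For c < d this is positive exactly on (c,d). The third power is what makes it twice
  continuously differentiable on the whole line, as membership in \<open>variations\<close>
  demands.\<close>

definition bump :: "real \<Rightarrow> real \<Rightarrow> real \<Rightarrow> real" where
  "bump c d x = (max 0 ((x - c) * (d - x))) ^ 3"

definition bump' :: "real \<Rightarrow> real \<Rightarrow> real \<Rightarrow> real" where
  "bump' c d x = 3 * (max 0 ((x - c) * (d - x)))\<^sup>2 * (c + d - 2 * x)"

text \<open>With w = (x - c)(d - x), the first term carries the square of w' = c + d - 2 x and the
  second comes from w'' = -2. A factor \<open>max 0 w\<close> survives in both, so this is
  continuous and vanishes wherever w is nonpositive.\<close>

definition bump'' :: "real \<Rightarrow> real \<Rightarrow> real \<Rightarrow> real" where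
  "bump'' c d x = 6 * max 0 ((x - c) * (d - x)) * (c + d - 2 * x)\<^sup>2 - 6 * (max 0 ((x - c) * (d - x)))\<^sup>2"

lemma bump_has_derivative:
  "(bump c d has_real_derivative bump' c d x) (at x)"
  "(bump' c d has_real_derivative bump'' c d x) (at x)"
proof -
  have w: "((\<lambda>x. (x - c) * (d - x)) has_real_derivative c + d - 2 * x) (at x)"
    by (auto intro!: derivative_eq_intros simp: algebra_simps)
  show "(bump c d has_real_derivative bump' c d x) (at x)"
    using DERIV_chain2[OF has_derivative_pos_part_power[of 1] w]
    by (simp add: bump_def[abs_def] bump'_def eval_nat_numeral)
  have sq: "((\<lambda>x. (max 0 ((x - c) * (d - x)))\<^sup>2) has_real_derivative
      2 * max 0 ((x - c) * (d - x)) * (c + d - 2 * x)) (at x)"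
    using DERIV_chain2[OF has_derivative_pos_part_power[of 0] w] by (simp add: eval_nat_numeral)
  show "(bump' c d has_real_derivative bump'' c d x) (at x)"
    unfolding bump'_def[abs_def] bump''_def
    by (rule derivative_eq_intros sq refl)+ (simp add: algebra_simps power2_eq_square)
qed

lemma bump_outside:
  assumes "c < d" "x \<notin> {c<..<d}"
  shows "bump c d x = 0" "bump' c d x = 0" "bump'' c d x = 0"
proof -
  have "(x - c) * (d - x) \<le> 0" using assms by (auto simp: mult_le_0_iff)
  then show "bump c d x = 0" "bump' c d x = 0" "bump'' c d x = 0"
    by (simp_all add: bump_def bump'_def bump''_def max_absorb1)
qed

lemma ddx_bump:
  assumes "x \<in> {0..1}"
  shows "ddx (bump c d) x = bump' c d x" "ddx (ddx (bump c d)) x = bump'' c d x"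
proof -
  have *: "ddx (bump c d) y = bump' c d y" if "y \<in> {0..1}" for y
    using that by (rule ddx_eqI[OF has_field_derivative_at_within[OF bump_has_derivative(1)]])
  then show "ddx (bump c d) x = bump' c d x" using assms .
  \<comment> \<open>Differentiating again requires the formula for \<open>ddx (bump c d)\<close> at
    all points of [0,1] near \<open>x\<close>, not just at \<open>x\<close>.\<close>
  have "(ddx (bump c d) has_real_derivative bump'' c d x) (at x within {0..1})"
    by (rule has_field_derivative_transform_within[OF
          has_field_derivative_at_within[OF bump_has_derivative(2)], of 1])
      (use assms * in auto)
  then show "ddx (ddx (bump c d)) x = bump'' c d x" using assms by (rule ddx_eqI)
qed

text \<open>The points 0 and 1 lie outside [c,d], so the bump and its derivative vanish there and
  every homogeneous endpoint condition holds, whatever \<open>B\<close> is.\<close>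

lemma bump_in_variations:
  assumes "0 < c" "c < d" "d < 1"
  shows "bump c d \<in> variations N xs B"
proof -
  have "continuous_on UNIV (bump'' c d)"
    unfolding bump''_def[abs_def] by (intro continuous_intros)
  then have "Ck_on (Suc (Suc 0)) UNIV (bump c d)"
    by (intro Ck_on_SucI_real[of _ _ "bump' c d"] Ck_on_SucI_real[of _ _ "bump'' c d"] bump_has_derivative)
      simp
  then have C2: "Ck_on 2 S (bump c d)" for S
    using Ck_on_subset[of 2 UNIV "bump c d" S] by (simp only: numeral_2_eq_2 top_greatest)
  then have "Ck_on 1 {0..1} (bump c d)" by (rule Ck_on_mono) simp
  moreover have "Ck_cells 2 N xs (bump c d)" unfolding Ck_cells_def using C2 by blast
  moreover have "endpoint_conditions B (bump c d)"
    unfolding endpoint_conditions_def using assms by (auto simp: ddx_bump bump_outside)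
  ultimately show ?thesis by (simp add: variations_def)
qed

text \<open>If \<open>f x0\<close> were nonzero, then \<open>f x0 * f x\<close> would be positive
  near \<open>x0\<close>; this factor treats both signs at once. Against a bump centred at
  \<open>x0\<close> the integrand is continuous and nonnegative with zero integral, hence zero, yet
  it is positive at \<open>x0\<close>.\<close>

lemma fundamental_lemma_bump:
  assumes f: "continuous_on {a<..<b} f"
    and int: "\<And>c d. a < c \<Longrightarrow> c < d \<Longrightarrow> d < b \<Longrightarrow> integral {c..d} (\<lambda>x. f x * bump c d x) = 0"
    and x0: "x0 \<in> {a<..<b}"
  shows "f x0 = 0"
proof (rule ccontr)
  assume nz: "f x0 \<noteq> 0"
  have "isCont f x0" using f x0 by (auto simp: continuous_on_eq_continuous_at)
  then have "((\<lambda>x. f x0 * f x) \<longlongrightarrow> f x0 * f x0) (at x0)"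
    by (intro tendsto_intros) (simp add: isCont_def)
  moreover have "0 < f x0 * f x0" using nz by (simp add: zero_less_mult_iff) linarith
  ultimately have "eventually (\<lambda>x. f x0 * f x > 0) (at x0)" by (rule order_tendstoD(1))
  then obtain e where e: "e > 0" "\<And>x. x \<noteq> x0 \<Longrightarrow> dist x x0 < e \<Longrightarrow> f x0 * f x > 0"
    unfolding eventually_at by auto
  \<comment> \<open>Halving the minimum keeps the closed interval of radius \<open>m\<close>
    strictly inside both (a,b) and the region of constant sign.\<close>
  define m where "m = Min {e, x0 - a, b - x0} / 2"
  have m: "m > 0" "m < e" "a < x0 - m" "x0 + m < b"
    using e x0 by (auto simp: m_def min_def field_simps)
  let ?c = "x0 - m" and ?d = "x0 + m"
  let ?g = "\<lambda>x. f x0 * (f x * bump ?c ?d x)"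
  have pos: "f x0 * f x > 0" if "x \<in> {?c..?d}" for x
    using e(2)[of x] that m \<open>0 < f x0 * f x0\<close> by (cases "x = x0") (auto simp: dist_real_def)
  have cont: "continuous_on {?c..?d} ?g"
    unfolding bump_def
    by (intro continuous_intros continuous_on_subset[OF f]) (use m in auto)
  have "integral {?c..?d} ?g = 0"
    using int[of ?c ?d] m by simp
  moreover have "0 \<le> ?g x" if "x \<in> {?c..?d}" for x
    using pos[OF that] by (simp add: bump_def mult.assoc[symmetric])
  ultimately have "?g x0 = 0"
    using integral_eq_0_iff[OF cont] m by auto
  moreover have "bump ?c ?d x0 > 0" using m by (simp add: bump_def max_def)
  ultimately show False using nz by simp
qed

section \<open>The first variation\<close>

text \<open>One total derivative \<open>dF\<close> is fixed on the closed strip, so that the three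
  coefficients become its values in fixed directions. It is of class 2 because the adjoint
  differentiates such a coefficient twice.\<close>

locale partitioned_integrand =
  fixes N :: nat and xs :: "nat \<Rightarrow> real" and F :: integrand
    and dF :: "real \<times> real \<times> real \<times> real \<Rightarrow> real \<times> real \<times> real \<times> real \<Rightarrow> real"
  assumes partition: "is_partition N xs"
    and F_deriv: "\<And>p. p \<in> {0..1} \<times> UNIV \<Longrightarrow>
      ((\<lambda>(x, z, p, q). F x z p q) has_derivative dF p) (at p within {0..1} \<times> UNIV)"
    and F_C2: "Ck_on 2 ({0..1} \<times> UNIV) (\<lambda>(x, z, p, q). F x z p q)"
    and dF_C2: "\<And>h. Ck_on 2 ({0..1} \<times> UNIV) (\<lambda>p. dF p h)"
begin

lemma Ck_cells_along_curve:
  assumes G: "Ck_on m ({0..1} \<times> UNIV) G"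
    and w: "Ck_cells m N xs w0" "Ck_cells m N xs w1" "Ck_cells m N xs w2"
  shows "Ck_cells m N xs (\<lambda>x. G (x, w0 x, w1 x, w2 x))"
  unfolding Ck_cells_def
proof
  fix j assume j: "j \<in> {1..N}"
  let ?K = "{xs (j - 1)..xs j}"
  obtain h0 h1 h2 where h: "Ck_on m ?K h0" "Ck_on m ?K h1" "Ck_on m ?K h2"
    and eq: "\<forall>t\<in>cell xs j. w0 t = h0 t" "\<forall>t\<in>cell xs j. w1 t = h1 t" "\<forall>t\<in>cell xs j. w2 t = h2 t"
    using w j unfolding Ck_cells_def by meson
  have "Ck_on m ?K (\<lambda>x. (x, h0 x, h1 x, h2 x) \<bullet> b)" if "b \<in> Basis" for b
    using that h by (auto simp: Basis_prod_def inner_prod_def Ck_on_linear bounded_linear_ident simp del: One_nat_def)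
  moreover have "(\<lambda>x. (x, h0 x, h1 x, h2 x)) ` ?K \<subseteq> {0..1} \<times> UNIV"
    using partition_bounds[OF partition j] by (auto simp del: One_nat_def)
  ultimately have "Ck_on m ?K (\<lambda>x. G (x, h0 x, h1 x, h2 x))"
    by (intro Ck_on_compose[OF G]) auto
  then show "\<exists>h. Ck_on m ?K h \<and> (\<forall>t\<in>cell xs j. G (t, w0 t, w1 t, w2 t) = h t)"
    using eq by (intro exI[of _ "\<lambda>x. G (x, h0 x, h1 x, h2 x)"]) auto
qed

section \<open>Directional derivatives of the integrand\<close>

lemma F_line_has_derivative:
  assumes "x \<in> {0..1}"
  shows "((\<lambda>t. F x (z + t * z') (p + t * p') (q + t * q')) has_real_derivative
    dF (x, z + t * z', p + t * p', q + t * q') (0, z', p', q')) (at t)"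
proof -
  let ?\<gamma> = "\<lambda>t. (x, z + t * z', p + t * p', q + t * q')"
  have "(?\<gamma> has_derivative (\<lambda>h. h *\<^sub>R (0, z', p', q'))) (at t)"
    by (auto intro!: derivative_eq_intros)
  \<comment> \<open>The direction has no x-component, so the whole line stays in the strip even when
    x is 0 or 1, and the derivative in \<open>t\<close> is two-sided.\<close>
  moreover have "range ?\<gamma> \<subseteq> {0..1} \<times> UNIV" using assms by auto
  ultimately have "((\<lambda>t. case ?\<gamma> t of (x, z, p, q) \<Rightarrow> F x z p q) has_derivative
      (\<lambda>h. dF (?\<gamma> t) (h *\<^sub>R (0, z', p', q')))) (at t)"
    using has_derivative_in_compose2[OF F_deriv] by blast
  moreover have "dF (?\<gamma> t) (h *\<^sub>R (0, z', p', q')) = dF (?\<gamma> t) (0, z', p', q') * h" for h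
  proof -
    have "?\<gamma> t \<in> {0..1} \<times> UNIV" using assms by auto
    then have "linear (dF (?\<gamma> t))" by (rule has_derivative_linear[OF F_deriv])
    then show ?thesis by (subst linear_scale) (simp_all only: real_scaleR_def mult.commute)
  qed
  ultimately show ?thesis
    unfolding has_field_derivative_def by (simp only: prod.case)
qed

text \<open>Linearity in coordinates. Combined with \<open>coeff_eq\<close> it turns
  \<open>dF\<close> along the jet of a variation into \<open>DF\<close>, and it reduces moving
  directions to fixed ones.\<close>

lemma dF_expand:
  assumes "x \<in> {0..1}"
  shows "dF (x, z, p, q) (0, z', p', q') =
    q' * dF (x, z, p, q) (0, 0, 0, 1) + p' * dF (x, z, p, q) (0, 0, 1, 0) + z' * dF (x, z, p, q) (0, 1, 0, 0)"
proof -
  have lin: "linear (dF (x, z, p, q))"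
    using F_deriv[of "(x, z, p, q)"] assms by (auto intro: has_derivative_linear)
  have "(0, z', p', q') = q' *\<^sub>R (0, 0, 0, 1) + p' *\<^sub>R (0, 0, 1, 0) + z' *\<^sub>R (0::real, 1::real, 0::real, 0::real)"
    by simp
  then show ?thesis by (simp only: linear_add[OF lin] linear_scale[OF lin] real_scaleR_def)
qed

lemma coeff_eq:
  assumes "x \<in> {0..1}"
  shows "coeff_a F u x = dF (x, u x, ddx u x, ddx (ddx u) x) (0, 0, 0, 1)"
    and "coeff_b F u x = dF (x, u x, ddx u x, ddx (ddx u) x) (0, 0, 1, 0)"
    and "coeff_c F u x = dF (x, u x, ddx u x, ddx (ddx u) x) (0, 1, 0, 0)"
proof -
  \<comment> \<open>Each partial derivative is the derivative along a line with base 0 and slope 1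
    in one slot, taken at the parameter equal to the actual value in that slot.\<close>
  note D = F_line_has_derivative[OF assms]
  show "coeff_a F u x = dF (x, u x, ddx u x, ddx (ddx u) x) (0, 0, 0, 1)"
    unfolding coeff_a_def using D[of "u x" 0 "ddx u x" 0 0 1 "ddx (ddx u) x"] by (auto intro: DERIV_imp_deriv)
  show "coeff_b F u x = dF (x, u x, ddx u x, ddx (ddx u) x) (0, 0, 1, 0)"
    unfolding coeff_b_def using D[of "u x" 0 0 1 "ddx (ddx u) x" 0 "ddx u x"] by (auto intro: DERIV_imp_deriv)
  show "coeff_c F u x = dF (x, u x, ddx u x, ddx (ddx u) x) (0, 1, 0, 0)"
    unfolding coeff_c_def using D[of 0 1 "ddx u x" 0 "ddx (ddx u) x" 0 "u x"] by (auto intro: DERIV_imp_deriv)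
qed

text \<open>Leibniz rule on one closed cell. The arguments stand for continuous extensions from the
  open cell, so the integrand and its \<open>t\<close>-derivative are jointly continuous up to the
  ends.\<close>

lemma has_derivative_square_integral:
  assumes ab: "{a..b} \<subseteq> {0..1}"
    and h: "continuous_on {a..b} h0" "continuous_on {a..b} h1" "continuous_on {a..b} h2"
    and k: "continuous_on {a..b} k0" "continuous_on {a..b} k1" "continuous_on {a..b} k2"
    and g: "continuous_on {a..b} g"
  shows "((\<lambda>t. integral {a..b} (\<lambda>x. (F x (h0 x + t * k0 x) (h1 x + t * k1 x) (h2 x + t * k2 x) - g x)\<^sup>2))
    has_real_derivative
      integral {a..b} (\<lambda>x. 2 * ((F x (h0 x) (h1 x) (h2 x) - g x) * dF (x, h0 x, h1 x, h2 x) (0, k0 x, k1 x, k2 x))))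
    (at 0)"
proof -
  let ?\<gamma> = "\<lambda>t x. (x, h0 x + t * k0 x, h1 x + t * k1 x, h2 x + t * k2 x)"
  let ?f = "\<lambda>t x. (F x (h0 x + t * k0 x) (h1 x + t * k1 x) (h2 x + t * k2 x) - g x)\<^sup>2"
  let ?f' = "\<lambda>t x. 2 * ((F x (h0 x + t * k0 x) (h1 x + t * k1 x) (h2 x + t * k2 x) - g x) *
    dF (?\<gamma> t x) (0, k0 x, k1 x, k2 x))"
  have cont: "continuous_on (UNIV \<times> {a..b}) (\<lambda>(t, x). G (?\<gamma> t x))"
    if "Ck_on 2 ({0..1} \<times> UNIV) G" for G
  proof -
    have snd': "continuous_on (UNIV \<times> {a..b}) (\<lambda>s. f (snd s))" if "continuous_on {a..b} f"
      for f :: "real \<Rightarrow> real"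
      by (rule continuous_on_compose2[OF that]) (auto intro: continuous_intros)
    have "continuous_on (UNIV \<times> {a..b}) (\<lambda>s. ?\<gamma> (fst s) (snd s))"
      by (intro continuous_intros snd' h k)
    then show ?thesis
      unfolding case_prod_beta
      using ab by (intro continuous_on_compose2[OF Ck_on_imp_continuous_on[OF that]]) auto
  qed
  have snd: "continuous_on (UNIV \<times> {a..b}) (\<lambda>(t::real, x). f x)" if "continuous_on {a..b} f"
    for f :: "real \<Rightarrow> real"
    unfolding case_prod_beta by (rule continuous_on_compose2[OF that]) (auto intro: continuous_intros)
  have F0: "continuous_on (UNIV \<times> {a..b})
      (\<lambda>(t, x). F x (h0 x + t * k0 x) (h1 x + t * k1 x) (h2 x + t * k2 x) - g x)"
    using continuous_on_diff[OF cont[OF F_C2] snd[OF g]] by (simp add: case_prod_beta)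
  \<comment> \<open>The direction depends on \<open>x\<close>, so \<open>dF\<close> is first
    expanded into fixed directions with continuous weights.\<close>
  have dF0: "continuous_on (UNIV \<times> {a..b}) (\<lambda>(t, x). dF (?\<gamma> t x) (0, k0 x, k1 x, k2 x))"
  proof -
    have "continuous_on (UNIV \<times> {a..b}) (\<lambda>s.
       (case s of (t, x) \<Rightarrow> k2 x) * (case s of (t, x) \<Rightarrow> dF (?\<gamma> t x) (0, 0, 0, 1)) +
       (case s of (t, x) \<Rightarrow> k1 x) * (case s of (t, x) \<Rightarrow> dF (?\<gamma> t x) (0, 0, 1, 0)) +
       (case s of (t, x) \<Rightarrow> k0 x) * (case s of (t, x) \<Rightarrow> dF (?\<gamma> t x) (0, 1, 0, 0)))"
      by (intro continuous_on_add continuous_on_mult snd k cont dF_C2)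
    then show ?thesis
      by (rule continuous_on_eq) (use ab in \<open>auto intro!: dF_expand[symmetric]\<close>)
  qed
  have "((\<lambda>t. integral (cbox a b) (?f t)) has_real_derivative integral (cbox a b) (?f' 0)) (at 0 within UNIV)"
  proof (rule leibniz_rule_field_derivative[where fx = ?f'])
    show "((\<lambda>t. ?f t x) has_real_derivative ?f' t x) (at t within UNIV)" if "x \<in> cbox a b" for t x
      using that ab by (auto intro!: derivative_eq_intros F_line_has_derivative)
    show "?f t integrable_on cbox a b" for t
    proof -
      have "continuous_on {a..b} (\<lambda>x. case (t, x) of (t, x) \<Rightarrow>
          F x (h0 x + t * k0 x) (h1 x + t * k1 x) (h2 x + t * k2 x) - g x)"
        by (rule continuous_on_compose2[OF F0]) (auto intro: continuous_intros)
      then show ?thesis by (auto intro!: integrable_continuous_real continuous_on_power)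
    qed
    show "continuous_on (UNIV \<times> cbox a b) (\<lambda>(t, x). ?f' t x)"
      using continuous_on_mult_left[OF continuous_on_mult[OF F0 dF0], of 2] by (simp add: case_prod_beta)
  qed auto
  then show ?thesis by simp
qed

text \<open>Split \<open>J\<close> into cell integrals and replace all data on each cell by
  continuous extensions. The factor 1/2 in \<open>J\<close> cancels the 2 from differentiating the
  square.\<close>

lemma J_has_derivative:
  assumes u: "Ck_cells 2 N xs u" and v: "Ck_cells 2 N xs v" and g: "Ck_cells 0 N xs g"
  shows "((\<lambda>t. J F g (\<lambda>x. u x + t * v x)) has_real_derivative
    (\<Sum>j = 1..N. integral (cell xs j) (\<lambda>x. residual F g u x * DF F u v x))) (at 0)"
proof -
  have u1: "Ck_cells 1 N xs (ddx u)" and v1: "Ck_cells 1 N xs (ddx v)"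
    using Ck_cells_ddx[OF partition, of 1] u v by (simp_all add: numeral_2_eq_2)
  have u2: "Ck_cells 0 N xs (ddx (ddx u))" and v2: "Ck_cells 0 N xs (ddx (ddx v))"
    using Ck_cells_ddx[OF partition, of 0] u1 v1 by simp_all
  have u0: "Ck_cells 0 N xs u" "Ck_cells 0 N xs v" "Ck_cells 0 N xs (ddx u)" "Ck_cells 0 N xs (ddx v)"
    using u v u1 v1 by (auto intro: Ck_cells_mono)
  define w where "w t x = u x + t * v x" for t x
  have w_ddx: "ddx (w t) x = ddx u x + t * ddx v x"
    "ddx (ddx (w t)) x = ddx (ddx u) x + t * ddx (ddx v) x"
    if x: "x \<in> cell xs j" and j: "j \<in> {1..N}" for t x j
  proof -
    have unit: "y \<in> {0..1}" if "y \<in> cell xs j" for y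
      using that partition_bounds[OF partition j] by (auto simp: cell_def)
    have first: "ddx (w t) y = ddx u y + t * ddx v y" if y: "y \<in> cell xs j" for y
    proof (rule ddx_eqI[OF _ unit[OF y]])
      have "(w t has_real_derivative ddx u y + t * ddx v y) (at y)"
        unfolding w_def using Ck_cells_has_derivative[OF partition _ j y, of 1] u v
        by (auto intro!: derivative_eq_intros simp: numeral_2_eq_2)
      then show "(w t has_real_derivative ddx u y + t * ddx v y) (at y within {0..1})"
        by (rule has_field_derivative_at_within)
    qed
    then show "ddx (w t) x = ddx u x + t * ddx v x" using x .
    show "ddx (ddx (w t)) x = ddx (ddx u) x + t * ddx (ddx v) x"
    proof (rule ddx_eqI[OF _ unit[OF x]])
      have "((\<lambda>y. ddx u y + t * ddx v y) has_real_derivative ddx (ddx u) x + t * ddx (ddx v) x) (at x)"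
        using Ck_cells_has_derivative[OF partition _ j x, of 0] u1 v1
        by (auto intro!: derivative_eq_intros)
      \<comment> \<open>The first-order formula holds on the whole open cell, a neighbourhood of
        \<open>x\<close>, and may therefore be differentiated.\<close>
      then have "(ddx (w t) has_real_derivative ddx (ddx u) x + t * ddx (ddx v) x) (at x)"
        by (rule has_field_derivative_transform_within_open[of _ _ _ "cell xs j"])
          (use x first in \<open>auto simp: cell_def\<close>)
      then show "(ddx (w t) has_real_derivative ddx (ddx u) x + t * ddx (ddx v) x) (at x within {0..1})"
        by (rule has_field_derivative_at_within)
    qed
  qed
  define I where "I j t = integral {xs (j - 1)..xs j} (\<lambda>x. (residual F g (w t) x)\<^sup>2)" for j t
  have I: "(\<forall>t. ((\<lambda>x. (residual F g (w t) x)\<^sup>2) has_integral I j t) {xs (j - 1)..xs j}) \<and>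
      (I j has_real_derivative 2 * integral (cell xs j) (\<lambda>x. residual F g u x * DF F u v x)) (at 0)"
    if j: "j \<in> {1..N}" for j
  proof -
    let ?K = "{xs (j - 1)..xs j}"
    have ab: "?K \<subseteq> {0..1}" using partition_bounds[OF partition j] by auto
    have extend: "\<exists>h. continuous_on ?K h \<and> (\<forall>x\<in>cell xs j. f x = h x)" if "Ck_cells 0 N xs f" for f
      using that j by (simp add: Ck_cells_def)
    obtain h0 where h0: "continuous_on ?K h0" "\<forall>x\<in>cell xs j. u x = h0 x"
      using extend[OF u0(1)] by blast
    obtain h1 where h1: "continuous_on ?K h1" "\<forall>x\<in>cell xs j. ddx u x = h1 x"
      using extend[OF u0(3)] by blast
    obtain h2 where h2: "continuous_on ?K h2" "\<forall>x\<in>cell xs j. ddx (ddx u) x = h2 x"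
      using extend[OF u2] by blast
    obtain k0 where k0: "continuous_on ?K k0" "\<forall>x\<in>cell xs j. v x = k0 x"
      using extend[OF u0(2)] by blast
    obtain k1 where k1: "continuous_on ?K k1" "\<forall>x\<in>cell xs j. ddx v x = k1 x"
      using extend[OF u0(4)] by blast
    obtain k2 where k2: "continuous_on ?K k2" "\<forall>x\<in>cell xs j. ddx (ddx v) x = k2 x"
      using extend[OF v2] by blast
    obtain g0 where g0: "continuous_on ?K g0" "\<forall>x\<in>cell xs j. g x = g0 x"
      using extend[OF g] by blast
    note c = h0(1) h1(1) h2(1) k0(1) k1(1) k2(1) g0(1)
    note eq = h0(2) h1(2) h2(2) k0(2) k1(2) k2(2) g0(2)
    let ?R = "\<lambda>t x. F x (h0 x + t * k0 x) (h1 x + t * k1 x) (h2 x + t * k2 x) - g0 x"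
    have R: "residual F g (w t) x = ?R t x" if "x \<in> cell xs j" for t x
      using that eq w_ddx[OF that j] by (simp add: residual_def) (simp add: w_def)
    have R0: "residual F g u x = F x (h0 x) (h1 x) (h2 x) - g0 x" if "x \<in> cell xs j" for x
      using that eq by (simp add: residual_def)
    have DFv: "DF F u v x = dF (x, h0 x, h1 x, h2 x) (0, k0 x, k1 x, k2 x)" if "x \<in> cell xs j" for x
    proof -
      have "x \<in> {0..1}" using that ab by (auto simp: cell_def)
      then show ?thesis using that eq by (simp add: DF_def coeff_eq dF_expand[of x _ _ _ "k0 x"])
    qed
    have "continuous_on ?K (\<lambda>x. (\<lambda>(x, z, p, q). F x z p q) (x, h0 x + t * k0 x, h1 x + t * k1 x, h2 x + t * k2 x) - g0 x)" for t
      by (intro continuous_on_diff c continuous_on_compose2[OF Ck_on_imp_continuous_on[OF F_C2]] continuous_intros)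
        (use ab in auto)
    then have "(\<lambda>x. (?R t x)\<^sup>2) integrable_on ?K" for t
      by (auto intro!: integrable_continuous_real continuous_on_power simp del: One_nat_def)
    then have "((\<lambda>x. (?R t x)\<^sup>2) has_integral integral ?K (\<lambda>x. (?R t x)\<^sup>2)) ?K" for t
      by (rule integrable_integral)
    then have int: "((\<lambda>x. (residual F g (w t) x)\<^sup>2) has_integral integral ?K (\<lambda>x. (?R t x)\<^sup>2)) ?K" for t
      by (rule has_integral_spike_cell) (simp add: R)
    then have Ij: "I j = (\<lambda>t. integral ?K (\<lambda>x. (?R t x)\<^sup>2))"
      unfolding I_def by (intro ext integral_unique)
    have "(I j has_real_derivative
        integral ?K (\<lambda>x. 2 * ((F x (h0 x) (h1 x) (h2 x) - g0 x) * dF (x, h0 x, h1 x, h2 x) (0, k0 x, k1 x, k2 x)))) (at 0)"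
      unfolding Ij by (rule has_derivative_square_integral[OF ab c])
    also have "integral ?K (\<lambda>x. 2 * ((F x (h0 x) (h1 x) (h2 x) - g0 x) * dF (x, h0 x, h1 x, h2 x) (0, k0 x, k1 x, k2 x)))
        = 2 * integral (cell xs j) (\<lambda>x. residual F g u x * DF F u v x)"
      unfolding integral_mult_right integral_cell[symmetric]
      by (intro arg_cong[where f = "(*) 2"] integral_cong) (simp add: R0 DFv)
    finally show ?thesis using int unfolding Ij by blast
  qed
  have "J F g (w t) = 1 / 2 * (\<Sum>j = 1..N. I j t)" for t
  proof -
    have "((\<lambda>x. (residual F g (w t) x)\<^sup>2) has_integral (\<Sum>j = 1..N. I j t)) {0..1}"
      using I by (intro has_integral_partition[OF partition]) blast
    then show ?thesis unfolding J_def by (simp only: integral_unique)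
  qed
  then have "(\<lambda>t. J F g (\<lambda>x. u x + t * v x)) = (\<lambda>t. 1 / 2 * (\<Sum>j = 1..N. I j t))"
    unfolding w_def by (rule ext)
  moreover have "((\<lambda>t. 1 / 2 * (\<Sum>j = 1..N. I j t)) has_real_derivative
     1 / 2 * (\<Sum>j = 1..N. 2 * integral (cell xs j) (\<lambda>x. residual F g u x * DF F u v x))) (at 0)"
    using I by (intro DERIV_cmult DERIV_sum) blast
  ultimately show ?thesis by (simp add: sum_distrib_left[symmetric])
qed

section \<open>Regularity of the coefficients, the residual and the adjoint\<close>

lemma Ck_cells_coeffs_residual:
  assumes u: "Ck_cells 4 N xs u" and g: "Ck_cells 2 N xs g"
  shows "Ck_cells 2 N xs (coeff_a F u)" "Ck_cells 2 N xs (coeff_b F u)"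
    "Ck_cells 2 N xs (coeff_c F u)" "Ck_cells 2 N xs (residual F g u)"
proof -
  \<comment> \<open>Four cellwise derivatives of \<open>u\<close> leave two for its second
    derivative, hence two for everything composed from the jet of \<open>u\<close>.\<close>
  have "Ck_cells 3 N xs (ddx u)"
    using Ck_cells_ddx[OF partition, of 3] u by simp
  moreover from this have "Ck_cells 2 N xs (ddx (ddx u))"
    using Ck_cells_ddx[OF partition, of 2] by simp
  ultimately have w: "Ck_cells 2 N xs u" "Ck_cells 2 N xs (ddx u)" "Ck_cells 2 N xs (ddx (ddx u))"
    using u by (auto intro: Ck_cells_mono)
  have unit: "x \<in> {0..1}" if "x \<in> cell xs j" "j \<in> {1..N}" for x j
    using that(1) partition_bounds[OF partition that(2)] by (auto simp: cell_def)
  show "Ck_cells 2 N xs (coeff_a F u)"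
    using Ck_cells_cong[OF Ck_cells_along_curve[OF dF_C2 w]] coeff_eq(1)[OF unit] by blast
  show "Ck_cells 2 N xs (coeff_b F u)"
    using Ck_cells_cong[OF Ck_cells_along_curve[OF dF_C2 w]] coeff_eq(2)[OF unit] by blast
  show "Ck_cells 2 N xs (coeff_c F u)"
    using Ck_cells_cong[OF Ck_cells_along_curve[OF dF_C2 w]] coeff_eq(3)[OF unit] by blast
  have "Ck_cells 2 N xs
      (\<lambda>x. (\<lambda>(x, z, p, q). F x z p q) (x, u x, ddx u x, ddx (ddx u) x) - g x)"
    by (intro Ck_cells_diff Ck_cells_along_curve[OF F_C2 w] g)
  then show "Ck_cells 2 N xs (residual F g u)"
    by (simp add: residual_def[abs_def])
qed

lemma Ck_cells_DF:
  assumes "Ck_cells 4 N xs u" "Ck_cells 2 N xs g" "Ck_cells 2 N xs v"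
  shows "Ck_cells 0 N xs (DF F u v)"
proof -
  have v1: "Ck_cells 1 N xs (ddx v)"
    using Ck_cells_ddx[OF partition, of 1 v] assms by (simp add: numeral_2_eq_2)
  then have v2: "Ck_cells 0 N xs (ddx (ddx v))"
    using Ck_cells_ddx[OF partition, of 0] by simp
  show ?thesis
    unfolding DF_def[abs_def]
    by (intro Ck_cells_add Ck_cells_mult v2 Ck_cells_mono[OF v1] Ck_cells_mono[OF assms(3)]
        Ck_cells_coeffs_residual[OF assms(1,2), THEN Ck_cells_mono]) simp_all
qed

text \<open>The product of \<open>coeff_a\<close> and the residual is cellwise of class 2, so its
  second derivative is still continuous; the fundamental lemma relies on this.\<close>

lemma Ck_cells_DF_adjoint:
  assumes "Ck_cells 4 N xs u" "Ck_cells 2 N xs g"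
  shows "Ck_cells 0 N xs (DF_adjoint F u (residual F g u))"
proof -
  note C2 = Ck_cells_coeffs_residual[OF assms]
  have "Ck_cells (Suc (Suc 0)) N xs (\<lambda>s. coeff_a F u s * residual F g u s)"
    "Ck_cells (Suc 0) N xs (\<lambda>s. coeff_b F u s * residual F g u s)"
    using Ck_cells_mult[OF C2(1,4)] Ck_cells_mono[OF Ck_cells_mult[OF C2(2,4)], of 1]
    by (simp_all add: numeral_2_eq_2)
  then show ?thesis
    unfolding DF_adjoint_def[abs_def]
    by (intro Ck_cells_add Ck_cells_diff Ck_cells_ddx[OF partition]
        Ck_cells_mono[OF Ck_cells_mult[OF C2(3,4)]]) simp_all
qed

text \<open>Integrate the Lagrange identity over the support [c,d]: the boundary terms vanish with
  the bump and its derivative. The sum on the left is the integral over [0,1], whose integrand is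
  zero off [c,d].\<close>

lemma integral_DF_bump:
  assumes u: "Ck_cells 4 N xs u" and g: "Ck_cells 2 N xs g"
    and j: "j \<in> {1..N}" and cd: "xs (j - 1) < c" "c < d" "d < xs j"
  defines "r \<equiv> residual F g u"
  shows "(\<Sum>i = 1..N. integral (cell xs i) (\<lambda>x. r x * DF F u (bump c d) x)) =
    integral {c..d} (\<lambda>x. DF_adjoint F u r x * bump c d x)"
proof -
  let ?v = "bump c d"
  note C2 = Ck_cells_coeffs_residual[OF u g, folded r_def]
  have unit: "x \<in> {0..1}" if "x \<in> {c..d}" for x
    using that cd partition_bounds[OF partition j] by auto
  have v: "Ck_cells 2 N xs ?v"
    using bump_in_variations[of c d N xs "{}"] cd partition_bounds[OF partition j]
    by (auto simp: variations_def)
  have sum: "((\<lambda>x. r x * DF F u ?v x) has_integral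
      (\<Sum>i = 1..N. integral (cell xs i) (\<lambda>x. r x * DF F u ?v x))) {0..1}"
  proof (rule has_integral_partition[OF partition])
    fix i assume i: "i \<in> {1..N}"
    have "Ck_cells 0 N xs (\<lambda>x. r x * DF F u ?v x)"
      by (intro Ck_cells_mult Ck_cells_DF[OF u g v] Ck_cells_mono[OF C2(4)]) simp
    then obtain h where h: "continuous_on {xs (i - 1)..xs i} h" "\<forall>x\<in>cell xs i. r x * DF F u ?v x = h x"
      using i unfolding Ck_cells_def Ck_on.simps by blast
    have "((\<lambda>x. r x * DF F u ?v x) has_integral integral {xs (i - 1)..xs i} h) {xs (i - 1)..xs i}"
      by (rule has_integral_spike_cell[OF integrable_integral[OF integrable_continuous_real[OF h(1)]]])
        (simp add: h(2))
    then show "((\<lambda>x. r x * DF F u ?v x) has_integral integral (cell xs i) (\<lambda>x. r x * DF F u ?v x)) {xs (i - 1)..xs i}"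
      unfolding integral_cell by (metis integral_unique)
  qed
  let ?ar = "\<lambda>s. coeff_a F u s * r s" and ?br = "\<lambda>s. coeff_b F u s * r s"
  \<comment> \<open>The boundary expression of the Lagrange identity, with \<open>bump'\<close> as
    the derivative of the test function.\<close>
  let ?M = "\<lambda>x. ?ar x * bump' c d x + (?br x - ddx ?ar x) * ?v x"
  let ?A = "\<lambda>x. DF_adjoint F u r x * ?v x"
  have ar: "Ck_cells (Suc (Suc 0)) N xs ?ar" and br: "Ck_cells (Suc 0) N xs ?br"
    using Ck_cells_mult[OF C2(1,4)] Ck_cells_mono[OF Ck_cells_mult[OF C2(2,4)], of 1]
    by (simp_all add: numeral_2_eq_2)
  have M: "(?M has_real_derivative r x * DF F u ?v x - ?A x) (at x)" if x: "x \<in> {c..d}" for x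
  proof -
    have xj: "x \<in> cell xs j" using x cd by (simp add: cell_def)
    note D = Ck_cells_has_derivative[OF partition ar j xj]
      Ck_cells_has_derivative[OF partition Ck_cells_ddx[OF partition ar] j xj]
      Ck_cells_has_derivative[OF partition br j xj]
      bump_has_derivative[of c d x]
    have "(?M has_real_derivative
        (ddx ?ar x * bump' c d x + bump'' c d x * ?ar x) +
        ((ddx ?br x - ddx (ddx ?ar) x) * ?v x + bump' c d x * (?br x - ddx ?ar x))) (at x)"
      by (intro DERIV_add DERIV_mult DERIV_diff D)
    then show ?thesis
      by (rule back_subst[of "\<lambda>D. (?M has_real_derivative D) (at x)"])
        (simp add: DF_def DF_adjoint_def ddx_bump[OF unit[OF x]] algebra_simps)
  qed
  have "((\<lambda>x. r x * DF F u ?v x - ?A x) has_integral ?M d - ?M c) {c..d}"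
    using cd by (intro fundamental_theorem_of_calculus)
      (auto simp: has_real_derivative_iff_has_vector_derivative[symmetric]
        intro!: M[THEN has_field_derivative_at_within])
  moreover have "?M c = 0" "?M d = 0" using cd by (simp_all add: bump_outside)
  ultimately have diff: "((\<lambda>x. r x * DF F u ?v x - ?A x) has_integral 0) {c..d}" by simp
  have "continuous_on (cell xs j) (DF_adjoint F u r)"
    unfolding r_def by (rule Ck_cells_imp_continuous_on[OF Ck_cells_DF_adjoint[OF u g] j])
  then have "continuous_on {c..d} (DF_adjoint F u r)"
    by (rule continuous_on_subset) (use cd in \<open>auto simp: cell_def\<close>)
  then have "?A integrable_on {c..d}"
    unfolding bump_def by (intro integrable_continuous_real continuous_intros)
  then have "((\<lambda>x. r x * DF F u ?v x) has_integral integral {c..d} ?A) {c..d}"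
    using has_integral_add[OF diff integrable_integral, of ?A] by simp
  \<comment> \<open>Extending by zero passes from [c,d] to [0,1], where the result can be compared
    with \<open>sum\<close> by uniqueness of integrals.\<close>
  then have "((\<lambda>x. if x \<in> {c..d} then r x * DF F u ?v x else 0) has_integral integral {c..d} ?A) {0..1}"
    by (subst has_integral_restrict) (use unit in auto)
  then have "((\<lambda>x. r x * DF F u ?v x) has_integral integral {c..d} ?A) {0..1}"
    by (rule has_integral_eq[rotated])
      (use cd in \<open>auto simp: DF_def ddx_bump bump_outside\<close>)
  with sum show ?thesis by (rule has_integral_unique)
qed

end

section \<open>The first variation formula and the criterion for critical points\<close>

theorem proposition6:
  fixes N :: nat and xs :: "nat \<Rightarrow> real"
    and F :: "real \<Rightarrow> real \<Rightarrow> real \<Rightarrow> real \<Rightarrow> real"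
    and g u r :: "real \<Rightarrow> real"
    and B :: "(real \<times> real \<times> real \<times> real) set"
  assumes "is_partition N xs"
    and "smooth_on ({0..1} \<times> UNIV) (\<lambda>(x, z, p, q). F x z p q)"
    and "Ck_on 1 {0..1} u" and "Ck_cells 4 N xs u"
    and "Ck_cells 2 N xs g"
    and "r = residual F g u"
  shows "(\<forall>v\<in>variations N xs B.
            (\<lambda>t. J F g (\<lambda>x. u x + t * v x)) differentiable (at 0) \<and>
            DJ F g u v = (\<Sum>j = 1..N. integral (cell xs j) (\<lambda>x. DF_adjoint F u r x * v x))
                         + interface_functional F N xs u r v) \<and>
         (critical_point F g (variations N xs B) u \<longleftrightarrow>
            (\<forall>j\<in>{1..N}. \<forall>x\<in>cell xs j. DF_adjoint F u r x = 0) \<and>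
            (\<forall>v\<in>variations N xs B. interface_functional F N xs u r v = 0))"
proof -
  \<comment> \<open>Three derivatives of the integrand leave its first derivative \<open>dF\<close>
    of class 2.\<close>
  have F3: "Ck_on (Suc 2) ({0..1} \<times> UNIV) (\<lambda>(x, z, p, q). F x z p q)"
    using assms(2) by (simp only: smooth_on_def)
  then obtain dF where dF:
      "\<And>p. p \<in> {0..1} \<times> UNIV \<Longrightarrow>
        ((\<lambda>(x, z, p, q). F x z p q) has_derivative dF p) (at p within {0..1} \<times> UNIV)"
      "\<And>h. Ck_on 2 ({0..1} \<times> UNIV) (\<lambda>p. dF p h)"
    unfolding Ck_on.simps by blast
  interpret partitioned_integrand N xs F dF
    by unfold_locales (fact assms(1) dF Ck_on_Suc_imp[OF F3])+
  have u: "Ck_cells 4 N xs u" and g: "Ck_cells 2 N xs g" by fact+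
  let ?adj = "\<lambda>v. \<Sum>j = 1..N. integral (cell xs j) (\<lambda>x. DF_adjoint F u r x * v x)"
  \<comment> \<open>Since \<open>deriv\<close> is informative only where a derivative exists,
    existence is established here; it also yields the differentiability claim.\<close>
  have J': "((\<lambda>t. J F g (\<lambda>x. u x + t * v x)) has_real_derivative
      (\<Sum>j = 1..N. integral (cell xs j) (\<lambda>x. r x * DF F u v x))) (at 0)"
    if "v \<in> variations N xs B" for v
    unfolding assms(6) using that
    by (intro J_has_derivative Ck_cells_mono[OF u] Ck_cells_mono[OF g]) (auto simp: variations_def)
  have DJ: "DJ F g u v = (\<Sum>j = 1..N. integral (cell xs j) (\<lambda>x. r x * DF F u v x))"
    if "v \<in> variations N xs B" for v
    unfolding DJ_def using J'[OF that] by (rule DERIV_imp_deriv)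
  have formula: "DJ F g u v = ?adj v + interface_functional F N xs u r v"
    if "v \<in> variations N xs B" for v
    unfolding DJ[OF that] interface_functional_def by (simp add: sum_subtractf)
  have adj_zero: "?adj v = 0" if "\<forall>j\<in>{1..N}. \<forall>x\<in>cell xs j. DF_adjoint F u r x = 0" for v
  proof (rule sum.neutral, rule ballI)
    fix j assume "j \<in> {1..N}"
    then have "integral (cell xs j) (\<lambda>x. DF_adjoint F u r x * v x) = integral (cell xs j) (\<lambda>x. 0)"
      using that by (intro integral_cong) auto
    then show "integral (cell xs j) (\<lambda>x. DF_adjoint F u r x * v x) = 0" by simp
  qed
  \<comment> \<open>Bumps inside one cell are admissible variations, so criticality makes every
    integral of the adjoint against such a bump vanish.\<close>
  have adjoint: "DF_adjoint F u r x = 0"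
    if crit: "critical_point F g (variations N xs B) u" and j: "j \<in> {1..N}" and x: "x \<in> cell xs j"
    for j x
  proof (rule fundamental_lemma_bump[of "xs (j - 1)" "xs j" "DF_adjoint F u r"])
    show "continuous_on {xs (j - 1)<..<xs j} (DF_adjoint F u r)"
      using Ck_cells_imp_continuous_on[OF Ck_cells_DF_adjoint[OF u g] j] by (simp add: assms(6) cell_def)
    show "x \<in> {xs (j - 1)<..<xs j}" using x by (simp only: cell_def)
    fix c d assume cd: "xs (j - 1) < c" "c < d" "d < xs j"
    have "bump c d \<in> variations N xs B"
      using cd partition_bounds[OF assms(1) j] by (intro bump_in_variations) auto
    then have "(\<Sum>i = 1..N. integral (cell xs i) (\<lambda>x. r x * DF F u (bump c d) x)) = 0"
      using crit DJ by (simp add: critical_point_def)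
    then show "integral {c..d} (\<lambda>x. DF_adjoint F u r x * bump c d x) = 0"
      using integral_DF_bump[OF u g j cd] by (simp add: assms(6))
  qed
  have "critical_point F g (variations N xs B) u \<longleftrightarrow>
      (\<forall>j\<in>{1..N}. \<forall>x\<in>cell xs j. DF_adjoint F u r x = 0) \<and>
      (\<forall>v\<in>variations N xs B. interface_functional F N xs u r v = 0)" (is "?crit \<longleftrightarrow> ?adj0 \<and> ?int")
  proof
    assume c: ?crit
    then have a: ?adj0 using adjoint by blast
    \<comment> \<open>Once the adjoint equations hold, the formula reads
      \<open>DJ F g u v = interface_functional F N xs u r v\<close>; the converse uses the same
      reduction.\<close>
    moreover have ?int
      using c formula unfolding critical_point_def by (simp add: adj_zero[OF a] del: One_nat_def)
    ultimately show "?adj0 \<and> ?int" ..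
  next
    assume *: "?adj0 \<and> ?int"
    then have a: ?adj0 by blast
    have "DJ F g u v = 0" if "v \<in> variations N xs B" for v
      using that * by (simp add: formula adj_zero[OF a] del: One_nat_def)
    then show ?crit by (simp add: critical_point_def)
  qed
  moreover have "(\<lambda>t. J F g (\<lambda>x. u x + t * v x)) differentiable (at 0)"
    if "v \<in> variations N xs B" for v
    using J'[OF that] unfolding real_differentiable_def by blast
  ultimately show ?thesis using formula by blast
qed

end
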